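(* Let $N_5=\{0,x,y,z,1\}$ be the pentagon lattice. Then $Q=\{x\}$ is a decomposition-closed sublattice of $N_5$ that is not the minimizer set of any modular function $F:N_5\to\mathbb{R}$.
   Context: The pentagon lattice $N_5=\{0,x,y,z,1\}$ has five distinct elements with covering relations exactly $0\lessdot x\lessdot y\lessdot 1$ and $0\lessdot z\lessdot 1$; in particular $z$ is incomparable to $x$ and to $y$, and $x<y$. For a finite lattice $S$ with meet $\wedge$ and join $\vee$: a function $F:S\to\mathbb{R}$ is modular if $F(s)+F(s')=F(s\wedge s')+F(s\vee s')$ for all $s,s'\in S$. A subset $Q\subseteq S$ is the minimizer set of $F$ if $Q=\arg\min_{s\in S}F(s)$. A sublattice is a nonempty subset closed under $\wedge$ and $\vee$ of $S$. For $a\le b$ in $S$, $[a,b]=\{t\in S: a\le t\le b\}$; a pair $s,s'\in[a,b]$ is a decomposition of $[a,b]$ if $s\wedge s'=a$ and $s\vee s'=b$. A sublattice $Q\subseteq S$ is decomposition closed if, whenever $a,b\in Q$ with $a\le b$ and $s,s'$ is a decomposition of $[a,b]$, both $s$ and $s'$ belong to $Q$. *)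

theory Defs
  imports Complex_Main
begin

definition modular_fun :: "('a::{finite,lattice} \<Rightarrow> real) \<Rightarrow> bool" where
  "modular_fun F \<longleftrightarrow> (\<forall>s s'. F s + F s' = F (inf s s') + F (sup s s'))"

definition minimizer_set_of :: "('a::{finite,lattice} \<Rightarrow> real) \<Rightarrow> 'a set \<Rightarrow> bool" where
  "minimizer_set_of F Q \<longleftrightarrow> Q = {s. is_arg_min F (\<lambda>t. t \<in> UNIV) s}"

definition sublattice :: "'a::{finite,lattice} set \<Rightarrow> bool" where
  "sublattice Q \<longleftrightarrow> Q \<noteq> {} \<and> (\<forall>s\<in>Q. \<forall>s'\<in>Q. inf s s' \<in> Q \<and> sup s s' \<in> Q)"

definition decomposition :: "'a::{finite,lattice} \<Rightarrow> 'a \<Rightarrow> 'a \<Rightarrow> 'a \<Rightarrow> bool" where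
  "decomposition a b s s' \<longleftrightarrow> s \<in> {a..b} \<and> s' \<in> {a..b} \<and> inf s s' = a \<and> sup s s' = b"

definition decomposition_closed :: "'a::{finite,lattice} set \<Rightarrow> bool" where
  "decomposition_closed Q \<longleftrightarrow>
    (\<forall>a\<in>Q. \<forall>b\<in>Q. a \<le> b \<longrightarrow> (\<forall>s s'. decomposition a b s s' \<longrightarrow> s \<in> Q \<and> s' \<in> Q))"

datatype N5 = Zero | X | Y | Z | One

lemma UNIV_N5: "(UNIV :: N5 set) = {Zero, X, Y, Z, One}"
  by (auto intro: N5.exhaust)

instance N5 :: finite
  by standard (simp add: UNIV_N5)

instantiation N5 :: order
begin

definition less_eq_N5 :: "N5 \<Rightarrow> N5 \<Rightarrow> bool" where
  "a \<le> b \<longleftrightarrow> a = b \<or> a = Zero \<or> b = One \<or> (a = X \<and> b = Y)"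

definition less_N5 :: "N5 \<Rightarrow> N5 \<Rightarrow> bool" where
  "(a :: N5) < b \<longleftrightarrow> a \<le> b \<and> a \<noteq> b"

instance
  by standard (auto simp: less_N5_def less_eq_N5_def)

end

instantiation N5 :: bounded_lattice
begin

(* Every pair of incomparable elements has meet Zero and join One. *)
definition inf_N5 :: "N5 \<Rightarrow> N5 \<Rightarrow> N5" where
  "inf a b = (if a \<le> b then a else if b \<le> a then b else Zero)"

definition sup_N5 :: "N5 \<Rightarrow> N5 \<Rightarrow> N5" where
  "sup a b = (if a \<le> b then b else if b \<le> a then a else One)"

definition bot_N5 :: N5 where
  "bot = Zero"

definition top_N5 :: N5 where
  "top = One"

instance
proof
  fix a b c :: N5
  show "inf a b \<le> a" "inf a b \<le> b"
    by (auto simp: inf_N5_def less_eq_N5_def)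
  show "a \<le> inf b c" if "a \<le> b" "a \<le> c"
    using that by (cases a; cases b; cases c; simp add: inf_N5_def less_eq_N5_def)
  show "a \<le> sup a b" "b \<le> sup a b"
    by (auto simp: sup_N5_def less_eq_N5_def)
  show "sup b c \<le> a" if "b \<le> a" "c \<le> a"
    using that by (cases a; cases b; cases c; simp add: sup_N5_def less_eq_N5_def)
  show "bot \<le> a"
    by (simp add: bot_N5_def less_eq_N5_def)
  show "a \<le> top"
    by (simp add: top_N5_def less_eq_N5_def)
qed

end

lemma N5_covering_relations:
  "{(a :: N5, b). a < b \<and> \<not> (\<exists>c. a < c \<and> c < b)}
    = {(Zero, X), (X, Y), (Y, One), (Zero, Z), (Z, One)}"
proof -
  have "(a < b \<and> \<not> (\<exists>c. a < c \<and> c < b))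
      \<longleftrightarrow> (a, b) \<in> {(Zero, X), (X, Y), (Y, One), (Zero, Z), (Z, One)}" for a b :: N5
  proof -
    have ex: "(\<exists>c. P c) \<longleftrightarrow> (\<exists>c\<in>{Zero, X, Y, Z, One}. P c)" for P
      using UNIV_N5 by (metis UNIV_I)
    show ?thesis
      by (cases a; cases b) (simp_all add: ex less_N5_def less_eq_N5_def)
  qed
  then show ?thesis by blast
qed

end

theory Submission
  imports Defs
begin

text \<open>A modular function cannot separate two complements of one element: \<open>X\<close> and
  \<open>Y\<close> have the same meet and join with \<open>Z\<close>, so cancelling
  \<open>F Z\<close> forces equal values (\<open>modular_fun_X_eq_Y\<close>). Hence \<open>X\<close>
  cannot be a minimizer without \<open>Y\<close> (\<open>minimizer_set_of_cong\<close>). The closure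
  properties hold for any singleton.\<close>

lemma singleton_sublattice: "sublattice {a}"
  by (simp add: sublattice_def)

text \<open>The only interval to check is \<open>{a..a}\<close>, whose sole point is
  \<open>a\<close>.\<close>

lemma singleton_decomposition_closed: "decomposition_closed {a}"
  by (auto simp: decomposition_closed_def decomposition_def)

(* Both X and Y are complements of Z. *)
lemma modular_fun_X_eq_Y:
  fixes F :: "N5 \<Rightarrow> real"
  assumes "modular_fun F"
  shows "F X = F Y"
proof -
  have "F X + F Z = F (inf X Z) + F (sup X Z)" "F Y + F Z = F (inf Y Z) + F (sup Y Z)"
    using assms unfolding modular_fun_def by blast+
  then show ?thesis
    by (simp add: inf_N5_def sup_N5_def less_eq_N5_def)
qed

text \<open>Being a minimizer depends on a point only through its value under
  \<open>F\<close>.\<close>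

lemma minimizer_set_of_cong:
  assumes "minimizer_set_of F Q" "F s = F t"
  shows "s \<in> Q \<longleftrightarrow> t \<in> Q"
  using assms by (simp add: minimizer_set_of_def is_arg_min_def)

theorem proposition2:
  shows "sublattice {X} \<and> decomposition_closed {X} \<and>
    \<not> (\<exists>F :: N5 \<Rightarrow> real. modular_fun F \<and> minimizer_set_of F {X})"
proof (intro conjI notI)
  assume "\<exists>F :: N5 \<Rightarrow> real. modular_fun F \<and> minimizer_set_of F {X}"
  then obtain F :: "N5 \<Rightarrow> real" where "modular_fun F" "minimizer_set_of F {X}"
    by blast
  then have "X \<in> {X} \<longleftrightarrow> Y \<in> {X}"
    using minimizer_set_of_cong modular_fun_X_eq_Y by blast
  then show False
    by simp
qed (rule singleton_sublattice singleton_decomposition_closed)+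

end
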